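(* Let $\mathcal{X}$ be a finite set with $|\mathcal{X}|\ge2$, $(\mathcal{X},\mathcal{E})$ a strongly connected directed graph, $\mathcal{E}^\star=\{(x,x'):(x',x)\in\mathcal{E}\}$, and let $P$ be irreducible over $(\mathcal{X},\mathcal{E})$ with time-reversal $P^\star$. Let $P_m=\arg\min_{\bar P\in\mathcal{W}_{\mathsf{rev}}(\mathcal{X},\mathcal{E}\cup\mathcal{E}^\star)}D(P\|\bar P)$ be the m-projection of $P$ onto $\mathcal{W}_{\mathsf{rev}}(\mathcal{X},\mathcal{E}\cup\mathcal{E}^\star)$. Then $$D(P\|P_m)=D(P^\star\|P_m).$$ If $(\mathcal{X},\mathcal{E}\cap\mathcal{E}^\star)$ is strongly connected and $P_e=\arg\min_{\bar P\in\mathcal{W}_{\mathsf{rev}}(\mathcal{X},\mathcal{E}\cap\mathcal{E}^\star)}D(\bar P\|P)$ is the e-projection of $P$ onto $\mathcal{W}_{\mathsf{rev}}(\mathcal{X},\mathcal{E}\cap\mathcal{E}^\star)$, then $$D(P_e\|P)=D(P_e\|P^\star).$$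
   Context: For a strongly connected graph $(\mathcal{X},\mathcal{E})$, $P$ is irreducible over $(\mathcal{X},\mathcal{E})$ if it is a row-stochastic matrix on $\mathcal{X}$ with $P(x,x')>0$ exactly for $(x,x')\in\mathcal{E}$. Such $P$ has a unique stationary distribution $\pi>0$; its time-reversal is $P^\star(x,x')=\pi(x')P(x',x)/\pi(x)$; $P$ is reversible if $P=P^\star$. $\mathcal{W}_{\mathsf{rev}}(\mathcal{X},\mathcal{E}')$: reversible kernels irreducible over $(\mathcal{X},\mathcal{E}')$. Information divergence, for $P_k$ irreducible over $(\mathcal{X},\mathcal{E}_k)$ with stationary distribution $\pi_k$, $k=1,2$: $D(P_1\|P_2)=\sum_{(x,x')\in\mathcal{E}_1}\pi_1(x)P_1(x,x')\log\frac{P_1(x,x')}{P_2(x,x')}$ if $\mathcal{E}_1\subset\mathcal{E}_2$, and $+\infty$ otherwise. The minimizers exist and are unique: $P_m=(P+P^\star)/2$, and $P_e(x,x')=\frac{\widetilde P_e(x,x')v(x')}{\rho v(x)}$ with $\widetilde P_e(x,x')=\sqrt{P(x,x')P^\star(x,x')}$, $\rho$ and $v$ being the Perron–Frobenius root and right Perron–Frobenius eigenvector of $\widetilde P_e$. *)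

theory Defs
  imports Complex_Main "HOL-Library.Extended_Real" "HOL-Library.Cardinality"
begin

text \<open>
  The finite state space is a type of class finite.  A directed graph on it is its edge relation,
  and a kernel is a real function of two states.
\<close>

type_synonym 'a kernel = "'a \<Rightarrow> 'a \<Rightarrow> real"

definition strongly_connected :: "('a \<times> 'a) set \<Rightarrow> bool" where
  "strongly_connected E \<longleftrightarrow> (\<forall>x x'. (x, x') \<in> E\<^sup>*)"

definition row_stochastic :: "('a::finite) kernel \<Rightarrow> bool" where
  "row_stochastic P \<longleftrightarrow> (\<forall>x x'. 0 \<le> P x x') \<and> (\<forall>x. (\<Sum>x'\<in>UNIV. P x x') = 1)"

definition edges :: "'a kernel \<Rightarrow> ('a \<times> 'a) set" where
  "edges P = {(x, x'). P x x' > 0}"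

definition irreducible_over :: "('a \<times> 'a) set \<Rightarrow> ('a::finite) kernel \<Rightarrow> bool" where
  "irreducible_over E P \<longleftrightarrow> strongly_connected E \<and> row_stochastic P \<and> edges P = E"

definition is_stationary :: "('a::finite) kernel \<Rightarrow> ('a \<Rightarrow> real) \<Rightarrow> bool" where
  "is_stationary P p \<longleftrightarrow>
     (\<forall>x. 0 \<le> p x) \<and> (\<Sum>x\<in>UNIV. p x) = 1 \<and> (\<forall>x'. (\<Sum>x\<in>UNIV. p x * P x x') = p x')"

text \<open>Meaningful only when \<open>P\<close> has a unique stationary distribution, as irreducible kernels do.\<close>

definition stationary :: "('a::finite) kernel \<Rightarrow> 'a \<Rightarrow> real" where
  "stationary P = (THE p. is_stationary P p)"

definition time_reversal :: "('a::finite) kernel \<Rightarrow> 'a kernel" where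
  "time_reversal P = (\<lambda>x x'. stationary P x' * P x' x / stationary P x)"

definition reversible :: "('a::finite) kernel \<Rightarrow> bool" where
  "reversible P \<longleftrightarrow> P = time_reversal P"

definition W_rev :: "('a \<times> 'a) set \<Rightarrow> ('a::finite) kernel set" where
  "W_rev E = {P. irreducible_over E P \<and> reversible P}"

text \<open>
  A kernel irreducible over a graph has exactly the edges of that graph as its support, so the two
  edge sets in the divergence are recovered from the kernels themselves.
\<close>

definition divergence :: "('a::finite) kernel \<Rightarrow> 'a kernel \<Rightarrow> ereal" where
  "divergence P Q =
     (if edges P \<subseteq> edges Q
      then ereal (\<Sum>(x, x')\<in>edges P. stationary P x * P x x' * ln (P x x' / Q x x'))
      else \<infinity>)"

definition is_m_projection :: "('a::finite) kernel \<Rightarrow> 'a kernel set \<Rightarrow> 'a kernel \<Rightarrow> bool" where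
  "is_m_projection P S Q \<longleftrightarrow> is_arg_min (\<lambda>R. divergence P R) (\<lambda>R. R \<in> S) Q"

definition is_e_projection :: "('a::finite) kernel \<Rightarrow> 'a kernel set \<Rightarrow> 'a kernel \<Rightarrow> bool" where
  "is_e_projection P S Q \<longleftrightarrow> is_arg_min (\<lambda>R. divergence R P) (\<lambda>R. R \<in> S) Q"

end

theory Submission
  imports Defs "HOL-Analysis.Determinants"
begin

text \<open>
  Time reversal preserves the divergence: \<open>D(P\<^sup>\<star>\<parallel>Q\<^sup>\<star>) = D(P\<parallel>Q)\<close> for irreducible \<open>P\<close> and \<open>Q\<close>.  Indeed,
  after exchanging \<open>x\<close> and \<open>x'\<close>, the two log-ratios differ by \<open>g x - g x'\<close> with \<open>g = ln (\<pi>\<^sub>P / \<pi>\<^sub>Q)\<close>, and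
  such a difference has mean zero under the stationary edge measure of \<open>P\<close>.  Both identities
  follow, since the projections are their own time-reversals.
\<close>

section \<open>Invariant vectors and the stationary distribution\<close>

text \<open>Signs and total mass are left free, unlike in \<open>is_stationary\<close>, so that
  differences and absolute values of solutions can be formed.\<close>

definition invariant :: "('a::finite) kernel \<Rightarrow> ('a \<Rightarrow> real) \<Rightarrow> bool" where
  "invariant P u \<longleftrightarrow> (\<forall>x'. (\<Sum>x\<in>UNIV. u x * P x x') = u x')"

lemma invariant_add: "invariant P u \<Longrightarrow> invariant P v \<Longrightarrow> invariant P (\<lambda>x. u x + v x)"
  by (simp add: invariant_def distrib_right sum.distrib)

lemma invariant_diff: "invariant P u \<Longrightarrow> invariant P v \<Longrightarrow> invariant P (\<lambda>x. u x - v x)"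
  by (simp add: invariant_def left_diff_distrib sum_subtractf)

text \<open>\<open>\<bar>u\<bar> \<le> \<bar>u\<bar>P\<close> holds pointwise by the triangle inequality, and both sides have the same total mass.\<close>

lemma invariant_abs:
  assumes P: "row_stochastic P" and u: "invariant P u"
  shows "invariant P (\<lambda>x. \<bar>u x\<bar>)"
proof -
  define d where "d x' = (\<Sum>x\<in>UNIV. \<bar>u x\<bar> * P x x') - \<bar>u x'\<bar>" for x'
  have nn: "0 \<le> P x x'" for x x'
    using P by (simp add: row_stochastic_def)
  have "\<bar>u x'\<bar> \<le> (\<Sum>x\<in>UNIV. \<bar>u x\<bar> * P x x')" for x'
  proof -
    have "\<bar>u x'\<bar> = \<bar>\<Sum>x\<in>UNIV. u x * P x x'\<bar>"
      using u by (simp add: invariant_def)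
    also have "\<dots> \<le> (\<Sum>x\<in>UNIV. \<bar>u x * P x x'\<bar>)" by (rule sum_abs)
    finally show ?thesis using nn by (simp add: abs_mult)
  qed
  then have d0: "0 \<le> d x'" for x' by (simp add: d_def)
  have "(\<Sum>x'\<in>UNIV. \<Sum>x\<in>UNIV. \<bar>u x\<bar> * P x x') = (\<Sum>x\<in>UNIV. \<bar>u x\<bar> * (\<Sum>x'\<in>UNIV. P x x'))"
    by (subst sum.swap) (simp add: sum_distrib_left)
  also have "\<dots> = (\<Sum>x\<in>UNIV. \<bar>u x\<bar>)"
    using P by (simp add: row_stochastic_def)
  finally have "(\<Sum>x'\<in>UNIV. d x') = 0"
    by (simp add: d_def sum_subtractf)
  then have "d x' = 0" for x'
    using d0 by (simp add: sum_nonneg_eq_0_iff)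
  then show ?thesis by (simp add: invariant_def d_def)
qed

text \<open>\<open>P - I\<close> annihilates the constant functions, so its transpose is singular as well.\<close>

lemma invariant_nonzero_exists:
  assumes "row_stochastic (P :: ('a::finite) kernel)"
  obtains u x where "invariant P u" "u x \<noteq> 0"
proof -
  define A :: "real^'a^'a" where "A = (\<chi> x x'. P x x') - mat 1"
  have P1: "(\<Sum>x'\<in>UNIV. P x x') = 1" for x
    using assms by (simp add: row_stochastic_def)
  have "A *v 1 = 0"
    by (simp add: A_def vec_eq_iff matrix_vector_mult_def mat_def sum_subtractf P1)
  moreover have "(1 :: real^'a) \<noteq> 0" by simp
  ultimately have "\<not> invertible A"
    by (metis matrix_left_invertible_ker invertible_def)
  then have "\<not> invertible (transpose A)"
    by (simp add: invertible_det_nz)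
  then obtain v where v: "transpose A *v v = 0" "v \<noteq> 0"
    by (metis matrix_left_invertible_ker invertible_left_inverse)
  have "(\<Sum>x\<in>UNIV. v $ x * P x x') = v $ x'" for x'
  proof -
    have "0 = (\<Sum>x\<in>UNIV. (P x x' - (if x = x' then 1 else 0)) * v $ x)"
      using arg_cong[OF v(1), of "\<lambda>w. w $ x'"]
      by (simp add: A_def matrix_vector_mult_def transpose_def mat_def)
    also have "\<dots> = (\<Sum>x\<in>UNIV. v $ x * P x x' - (if x = x' then v $ x else 0))"
      by (rule sum.cong) (auto simp: algebra_simps)
    finally show ?thesis by (simp add: sum_subtractf)
  qed
  then have "invariant P (\<lambda>x. v $ x)" by (simp add: invariant_def)
  moreover obtain x where "v $ x \<noteq> 0"
    using v(2) by (auto simp: vec_eq_iff)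
  ultimately show thesis by (rule that)
qed

text \<open>Positivity spreads along edges: \<open>u z\<close> is a sum of nonnegative terms, one of
  which is \<open>u y * P y z\<close>. Strong connectivity supplies a path from \<open>x\<close> to
  every state.\<close>

lemma invariant_pos:
  assumes P: "irreducible_over E P" and u: "invariant P u"
    and nn: "\<And>x. 0 \<le> u x" and x: "0 < u x"
  shows "0 < u y"
proof -
  have "(x, y) \<in> E\<^sup>*"
    using P by (simp add: irreducible_over_def strongly_connected_def)
  then show ?thesis
  proof (induction rule: rtrancl_induct)
    case base
    show ?case by (rule x)
  next
    case (step y z)
    have "0 < P y z"
      using P step.hyps by (auto simp: irreducible_over_def edges_def)
    with step.IH have "0 < u y * P y z" by simp
    also have "\<dots> \<le> (\<Sum>w\<in>UNIV. u w * P w z)"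
      using P nn by (intro member_le_sum) (auto simp: irreducible_over_def row_stochastic_def)
    also have "\<dots> = u z"
      using u by (simp add: invariant_def)
    finally show ?case .
  qed
qed

lemma is_stationary_iff:
  "is_stationary P p \<longleftrightarrow> (\<forall>x. 0 \<le> p x) \<and> (\<Sum>x\<in>UNIV. p x) = 1 \<and> invariant P p"
  by (simp add: is_stationary_def invariant_def)

text \<open>The absolute value of a nonzero invariant vector is again invariant; dividing by its
  total mass, which is positive, makes it a distribution.\<close>

lemma is_stationary_exists:
  assumes P: "row_stochastic P"
  shows "\<exists>p. is_stationary P p"
proof -
  obtain u x where u: "invariant P u" "u x \<noteq> 0"
    using invariant_nonzero_exists[OF P] .
  define s where "s = (\<Sum>x\<in>UNIV. \<bar>u x\<bar>)"
  have "\<bar>u x\<bar> \<le> s"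
    unfolding s_def by (intro member_le_sum) auto
  with u(2) have s: "0 < s" by linarith
  have "invariant P (\<lambda>x. \<bar>u x\<bar> / s)"
    using invariant_abs[OF P u(1)] by (simp add: invariant_def flip: sum_divide_distrib)
  moreover have "(\<Sum>x\<in>UNIV. \<bar>u x\<bar> / s) = 1"
    using s by (simp add: s_def flip: sum_divide_distrib)
  ultimately have "is_stationary P (\<lambda>x. \<bar>u x\<bar> / s)"
    using s by (simp add: is_stationary_iff)
  then show ?thesis by blast
qed

lemma is_stationary_unique:
  assumes P: "irreducible_over E P" and p: "is_stationary P p" and q: "is_stationary P q"
  shows "p = q"
proof -
  define r where "r x = p x - q x" for x
  have r: "invariant P r"
    using p q unfolding r_def by (intro invariant_diff) (auto simp: is_stationary_iff)
  have "row_stochastic P" using P by (simp add: irreducible_over_def)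
  \<comment> \<open>This vector is twice the positive part of \<open>r\<close>: it is invariant and
    nonnegative, so one positive entry makes all entries positive. Then \<open>r\<close> itself is
    positive everywhere, although its entries sum to zero.\<close>
  then have u: "invariant P (\<lambda>x. \<bar>r x\<bar> + r x)"
    using r by (intro invariant_add invariant_abs)
  have sum0: "(\<Sum>x\<in>UNIV. r x) = 0"
    using p q by (simp add: r_def sum_subtractf is_stationary_iff)
  have "r x \<le> 0" for x
  proof (rule ccontr)
    assume "\<not> r x \<le> 0"
    then have "0 < \<bar>r x\<bar> + r x" by simp
    then have "0 < \<bar>r y\<bar> + r y" for y
      by (rule invariant_pos[OF P u, rotated]) simp
    then have pos: "0 < r y" for y
      by (metis abs_of_nonpos add.left_inverse linorder_not_le order_less_irrefl)
    have "0 < (\<Sum>y\<in>UNIV. r y)"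
      using pos by (intro sum_pos) auto
    then show False using sum0 by simp
  qed
  then have "r x = 0" for x
    using sum0 sum_nonneg_eq_0_iff[of UNIV "\<lambda>x. - r x"] by (simp add: sum_negf)
  then show ?thesis by (auto simp: r_def)
qed

lemma stationary_eqI:
  assumes "irreducible_over E P" "is_stationary P p"
  shows "stationary P = p"
  unfolding stationary_def using assms by (blast intro: is_stationary_unique)

lemma is_stationary_stationary:
  assumes "irreducible_over E P"
  shows "is_stationary P (stationary P)"
proof -
  obtain p where "is_stationary P p"
    using assms is_stationary_exists by (auto simp: irreducible_over_def)
  then show ?thesis using stationary_eqI[OF assms] by simp
qed

text \<open>Total mass one forces a positive entry somewhere, and irreducibility spreads it to every
  state.\<close>

lemma stationary_pos:
  assumes P: "irreducible_over E P"
  shows "0 < stationary P y"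
proof -
  have st: "is_stationary P (stationary P)"
    using P by (rule is_stationary_stationary)
  then have nn: "0 \<le> stationary P x" for x
    by (simp add: is_stationary_iff)
  have "\<exists>x. stationary P x \<noteq> 0"
  proof (rule ccontr)
    assume "\<nexists>x. stationary P x \<noteq> 0"
    then show False using st by (simp add: is_stationary_iff)
  qed
  then obtain x where "0 < stationary P x"
    using nn by (metis order_le_less)
  moreover have "invariant P (stationary P)"
    using st by (simp add: is_stationary_iff)
  ultimately show ?thesis
    using nn invariant_pos[OF P] by blast
qed

section \<open>The time-reversed kernel\<close>

lemma edges_time_reversal:
  assumes "irreducible_over E P"
  shows "edges (time_reversal P) = (edges P)\<inverse>"
  using stationary_pos[OF assms]
  by (auto simp: edges_def time_reversal_def zero_less_divide_iff zero_less_mult_iff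
      dest: order.asym)

lemma irreducible_time_reversal:
  assumes P: "irreducible_over E P"
  shows "irreducible_over (E\<inverse>) (time_reversal P)"
proof -
  have pos: "0 < stationary P x" for x using stationary_pos[OF P] .
  have "strongly_connected (E\<inverse>)"
    using P by (simp add: irreducible_over_def strongly_connected_def rtrancl_converse)
  \<comment> \<open>The row sum at \<open>x\<close> is the stationarity equation of \<open>P\<close>
    at \<open>x\<close>, divided by \<open>stationary P x\<close>.\<close>
  moreover have "(\<Sum>x'\<in>UNIV. time_reversal P x x') = 1" for x
    using is_stationary_stationary[OF P] pos[of x]
    by (simp add: time_reversal_def is_stationary_def flip: sum_divide_distrib)
  moreover have "0 \<le> time_reversal P x x'" for x x'
    using P pos by (simp add: time_reversal_def irreducible_over_def row_stochastic_def less_imp_le)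
  moreover have "edges (time_reversal P) = E\<inverse>"
    using edges_time_reversal[OF P] P by (simp add: irreducible_over_def)
  ultimately show ?thesis by (simp add: irreducible_over_def row_stochastic_def)
qed

text \<open>Reversal transposes the edge measure \<open>stationary P x * P x x'\<close>, so
  stationarity for the reversed kernel reduces to the row sums of \<open>P\<close>.\<close>

lemma stationary_time_reversal:
  assumes P: "irreducible_over E P"
  shows "stationary (time_reversal P) = stationary P"
proof -
  have "stationary P x \<noteq> 0" for x using stationary_pos[OF P, of x] by simp
  then have "invariant (time_reversal P) (stationary P)"
    using P by (simp add: invariant_def time_reversal_def irreducible_over_def row_stochastic_def
        flip: sum_distrib_left)
  then have "is_stationary (time_reversal P) (stationary P)"
    using is_stationary_stationary[OF P] by (simp add: is_stationary_iff)
  then show ?thesis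
    using irreducible_time_reversal[OF P] by (rule stationary_eqI[rotated])
qed

section \<open>Divergence under time reversal\<close>

text \<open>Both marginals of the edge measure equal \<open>stationary P\<close>: the first by the
  row sums, the second by stationarity. Hence \<open>g x\<close> and \<open>g x'\<close> have the
  same mean.\<close>

lemma sum_edges_stationary_diff:
  assumes P: "irreducible_over E P"
  shows "(\<Sum>(x, x')\<in>edges P. stationary P x * P x x' * (g x - g x')) = 0"
proof -
  have "P x x' = 0" if "(x, x') \<notin> edges P" for x x'
    using that P by (simp add: edges_def irreducible_over_def row_stochastic_def order_antisym not_less)
  then have "(\<Sum>(x, x')\<in>edges P. stationary P x * P x x' * (g x - g x'))
      = (\<Sum>(x, x')\<in>UNIV \<times> UNIV. stationary P x * P x x' * (g x - g x'))"
    by (intro sum.mono_neutral_left) auto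
  also have "\<dots> = (\<Sum>x\<in>UNIV. \<Sum>x'\<in>UNIV. stationary P x * P x x' * (g x - g x'))"
    by (rule sum.cartesian_product[symmetric])
  also have "\<dots> = (\<Sum>x\<in>UNIV. stationary P x * g x * (\<Sum>x'\<in>UNIV. P x x'))
      - (\<Sum>x\<in>UNIV. \<Sum>x'\<in>UNIV. stationary P x * P x x' * g x')"
    by (simp add: right_diff_distrib sum_subtractf sum_distrib_left mult_ac)
  also have "(\<Sum>x\<in>UNIV. \<Sum>x'\<in>UNIV. stationary P x * P x x' * g x')
      = (\<Sum>x'\<in>UNIV. (\<Sum>x\<in>UNIV. stationary P x * P x x') * g x')"
    by (subst sum.swap) (simp add: sum_distrib_right)
  also have "(\<Sum>x\<in>UNIV. stationary P x * g x * (\<Sum>x'\<in>UNIV. P x x'))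
      - (\<Sum>x'\<in>UNIV. (\<Sum>x\<in>UNIV. stationary P x * P x x') * g x') = 0"
    using P is_stationary_stationary[OF P]
    by (simp add: irreducible_over_def row_stochastic_def is_stationary_def)
  finally show ?thesis .
qed

lemma divergence_time_reversal:
  assumes P: "irreducible_over E P" and Q: "irreducible_over F Q"
  shows "divergence (time_reversal P) (time_reversal Q) = divergence P Q"
proof (cases "edges P \<subseteq> edges Q")
  case False
  \<comment> \<open>Reversal replaces both edge sets by their converses, so the inclusion fails
    there too and both divergences are infinite.\<close>
  then show ?thesis
    using P Q by (simp add: divergence_def edges_time_reversal)
next
  case True
  let ?p = "stationary P" and ?q = "stationary Q"
  define g where "g x = ln (?p x / ?q x)" for x
  have p: "0 < ?p x" and q: "0 < ?q x" for x
    using stationary_pos[OF P] stationary_pos[OF Q] by auto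
  have term_eq: "?p x' * time_reversal P x' x * ln (time_reversal P x' x / time_reversal Q x' x)
      = ?p x * P x x' * ln (P x x' / Q x x') + ?p x * P x x' * (g x - g x')"
    if "(x, x') \<in> edges P" for x x'
  proof -
    have pos: "0 < P x x'" "0 < Q x x'"
      using that True by (auto simp: edges_def)
    have "ln (time_reversal P x' x / time_reversal Q x' x) = ln (P x x' / Q x x') + (g x - g x')"
      using pos p[of x] p[of x'] q[of x] q[of x']
      by (simp add: time_reversal_def g_def ln_div ln_mult)
    moreover have "?p x' * time_reversal P x' x = ?p x * P x x'"
      using p[of x'] by (simp add: time_reversal_def)
    ultimately show ?thesis by (simp add: distrib_left)
  qed
  \<comment> \<open>Exchanging endpoints turns the sum over reversed edges into one over the edges
    of \<open>P\<close>, where \<open>term_eq\<close> applies.\<close>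
  have "(\<Sum>(x, x')\<in>(edges P)\<inverse>. ?p x * time_reversal P x x'
        * ln (time_reversal P x x' / time_reversal Q x x'))
      = (\<Sum>(x, x')\<in>edges P. ?p x' * time_reversal P x' x
        * ln (time_reversal P x' x / time_reversal Q x' x))"
    by (rule sum.reindex_bij_witness[where i = prod.swap and j = prod.swap]) auto
  also have "\<dots> = (\<Sum>(x, x')\<in>edges P. ?p x * P x x' * ln (P x x' / Q x x')
        + ?p x * P x x' * (g x - g x'))"
    by (rule sum.cong) (auto simp: term_eq)
  also have "\<dots> = (\<Sum>(x, x')\<in>edges P. ?p x * P x x' * ln (P x x' / Q x x'))"
    using sum_edges_stationary_diff[OF P, of g] by (simp add: case_prod_unfold sum.distrib)
  finally show ?thesis
    using P Q True by (simp add: divergence_def edges_time_reversal stationary_time_reversal)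
qed

theorem proposition6p1:
  fixes E :: "('a::finite \<times> 'a) set" and P :: "'a kernel"
  assumes "CARD('a) \<ge> 2"
    and "strongly_connected E"
    and "irreducible_over E P"
  shows "(\<forall>Pm. is_m_projection P (W_rev (E \<union> converse E)) Pm
            \<longrightarrow> divergence P Pm = divergence (time_reversal P) Pm)
       \<and> (strongly_connected (E \<inter> converse E) \<longrightarrow>
           (\<forall>Pe. is_e_projection P (W_rev (E \<inter> converse E)) Pe
              \<longrightarrow> divergence Pe P = divergence Pe (time_reversal P)))"
proof (intro conjI allI impI)
  fix Pm assume "is_m_projection P (W_rev (E \<union> converse E)) Pm"
  then have irr: "irreducible_over (E \<union> converse E) Pm" and rev: "time_reversal Pm = Pm"
    by (auto simp: is_m_projection_def is_arg_min_def W_rev_def reversible_def)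
  show "divergence P Pm = divergence (time_reversal P) Pm"
    \<comment> \<open>Reversing both arguments sends \<open>P\<close> to its reversal and fixes
      \<open>Pm\<close>.\<close>
    using divergence_time_reversal[OF assms(3) irr] rev by simp
next
  fix Pe assume "is_e_projection P (W_rev (E \<inter> converse E)) Pe"
  then have irr: "irreducible_over (E \<inter> converse E) Pe" and rev: "time_reversal Pe = Pe"
    by (auto simp: is_e_projection_def is_arg_min_def W_rev_def reversible_def)
  show "divergence Pe P = divergence Pe (time_reversal P)"
    \<comment> \<open>Here the reversible kernel \<open>Pe\<close> is the first argument, so the
      edge measure is that of \<open>Pe\<close>.\<close>
    using divergence_time_reversal[OF irr assms(3)] rev by simp
qed

end
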